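(* Consider the total differential system in two variables $t,s$ with unknowns $x,y,z,w,q,p$ and parameters $\alpha_0,\alpha_1\in\mathbb{C}$, $\alpha_0+\alpha_1=1$: $$\begin{aligned} dx&=(-2xp-\alpha_0)\,dt+(-2xz-2\alpha_0w)\,ds,\\ dy&=(2yp+\alpha_1)\,dt+(2yz-2\alpha_1q)\,ds,\\ dz&=\tfrac{x+y}{2}\,dt+(-xq+yw-2p)\,ds,\\ dw&=(z-2wp)\,dt+(-2xp-2\alpha_0-\alpha_1)\,ds,\\ dq&=(z+2qp)\,dt+(2yp+\alpha_0+2\alpha_1)\,ds,\\ dp&=\tfrac{w+q}{2}\,dt+\tfrac{x+y}{2}\,ds. \end{aligned}$$ This system admits the extended affine Weyl group symmetry of type $A_1^{(1)}$ as a group of Bäcklund transformations, with generators $s_0,s_1,\pi$ acting on $( * )=(x,y,z,w,q,p;\alpha_0,\alpha_1)$ by $$s_0:( * )\mapsto\Big(x,\ y+\tfrac{4\alpha_0z}{x}+\tfrac{4\alpha_0^2w}{x^2},\ z+\tfrac{2\alpha_0w}{x},\ w,\ q+\tfrac{4\alpha_0p}{x}+\tfrac{2\alpha_0^2}{x^2},\ p+\tfrac{\alpha_0}{x};\ -\alpha_0,\ \alpha_1+2\alpha_0\Big),$$ $$s_1:( * )\mapsto\Big(x-\tfrac{4\alpha_1z}{y}+\tfrac{4\alpha_1^2q}{y^2},\ y,\ z-\tfrac{2\alpha_1q}{y},\ w-\tfrac{4\alpha_1p}{y}-\tfrac{2\alpha_1^2}{y^2},\ q,\ p+\tfrac{\alpha_1}{y};\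 \alpha_0+2\alpha_1,\ -\alpha_1\Big),$$ $$\pi:( * )\mapsto(-y,-x,-z,-q,-w,-p;\ \alpha_1,\alpha_0).$$
   Context: A Bäcklund transformation here is a birational transformation of the dependent variables and parameters that takes the system to the same system with the transformed parameters (with $t,s$ unchanged). The transformations are regarded as automorphisms of the field of rational functions in the variables and parameters. "Extended affine Weyl group symmetry of type $A_1^{(1)}$ with generators $s_0,s_1,\pi$" means that each of $s_0,s_1,\pi$ is a Bäcklund transformation and that they satisfy the defining relations $s_0^2=s_1^2=\pi^2=1$, $\pi s_0=s_1\pi$. *)

theory Defs
  imports Complex_Main "HOL-Library.Poly_Mapping" "HOL-Computational_Algebra.Fraction_Field"
begin

datatype var = T | S | X | Y | Z | W | Q | P | A0

text \<open>The linear order on \<open>var\<close> only serves to obtain the library's \<open>idom\<close> instance for polynomials.\<close>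

instantiation var :: linorder
begin

fun var_index :: "var \<Rightarrow> nat" where
  "var_index T = 0" | "var_index S = 1" | "var_index X = 2" | "var_index Y = 3" | "var_index Z = 4"
| "var_index W = 5" | "var_index Q = 6" | "var_index P = 7" | "var_index A0 = 8"

definition less_eq_var :: "var \<Rightarrow> var \<Rightarrow> bool" where
  "less_eq_var u v \<longleftrightarrow> var_index u \<le> var_index v"

definition less_var :: "var \<Rightarrow> var \<Rightarrow> bool" where
  "less_var u v \<longleftrightarrow> var_index u < var_index v"

instance
proof
  fix u v :: var
  show "u \<le> v \<Longrightarrow> v \<le> u \<Longrightarrow> u = v"
    unfolding less_eq_var_def by (cases u; cases v) simp_all
qed (auto simp: less_eq_var_def less_var_def)

end

text \<open>The polynomial ring \<open>\<complex>[t,s,x,y,z,w,q,p,\<alpha>\<^sub>0]\<close> and its field of fractions. The parameter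
  \<open>\<alpha>\<^sub>1\<close> is not a further indeterminate but the element \<open>1 - \<alpha>\<^sub>0\<close>, since the
  parameters are subject to \<open>\<alpha>\<^sub>0 + \<alpha>\<^sub>1 = 1\<close>.\<close>

type_synonym pol = "(var \<Rightarrow>\<^sub>0 nat) \<Rightarrow>\<^sub>0 complex"
type_synonym ratfun = "pol fract"

definition const :: "complex \<Rightarrow> ratfun" where
  "const c = Fract (Poly_Mapping.single 0 c) 1"

definition V :: "var \<Rightarrow> ratfun" where
  "V v = Fract (Poly_Mapping.single (Poly_Mapping.single v 1) 1) 1"

abbreviation alpha0 :: ratfun where "alpha0 \<equiv> V A0"
abbreviation alpha1 :: ratfun where "alpha1 \<equiv> 1 - V A0"

definition pdiff_pol :: "var \<Rightarrow> pol \<Rightarrow> pol" where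
  "pdiff_pol v f = (\<Sum>m\<in>Poly_Mapping.keys f.
     Poly_Mapping.single (m - Poly_Mapping.single v 1)
       (of_nat (Poly_Mapping.lookup m v) * Poly_Mapping.lookup f m))"

lemma pdiff_pol_superset:
  assumes "finite K" "Poly_Mapping.keys f \<subseteq> K"
  shows "pdiff_pol v f = (\<Sum>m\<in>K. Poly_Mapping.single (m - Poly_Mapping.single v 1)
       (of_nat (Poly_Mapping.lookup m v) * Poly_Mapping.lookup f m))"
  unfolding pdiff_pol_def using assms
  by (intro sum.mono_neutral_left) (auto simp: in_keys_iff)

lemma pdiff_pol_add: "pdiff_pol v (f + g) = pdiff_pol v f + pdiff_pol v g"
proof -
  let ?K = "Poly_Mapping.keys f \<union> Poly_Mapping.keys g"
  have K: "finite ?K" by simp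
  show ?thesis
    using pdiff_pol_superset[OF K keys_add] pdiff_pol_superset[OF K, of f] pdiff_pol_superset[OF K, of g]
    by (simp add: lookup_add distrib_left single_add sum.distrib)
qed

lemma pdiff_pol_single:
  "pdiff_pol v (Poly_Mapping.single m c) =
     Poly_Mapping.single (m - Poly_Mapping.single v 1) (of_nat (Poly_Mapping.lookup m v) * c)"
  by (cases "c = 0") (simp_all add: pdiff_pol_def)

lemma pol_induct [case_names zero single add]:
  fixes f :: pol
  assumes "R 0" "\<And>m c. R (Poly_Mapping.single m c)" "\<And>f g. R f \<Longrightarrow> R g \<Longrightarrow> R (f + g)"
  shows "R f"
proof (induction f rule: update_induct)
  case const
  show ?case by (rule assms(1))
next
  case (update f a b)
  have "Poly_Mapping.update a b f = f + Poly_Mapping.single a b"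
    using update by (intro poly_mapping_eqI)
      (auto simp: lookup_update lookup_add lookup_single when_def in_keys_iff)
  then show ?case using assms update by simp
qed

lemma monom_diff_add:
  fixes m n :: "var \<Rightarrow>\<^sub>0 nat"
  assumes "Poly_Mapping.lookup m v > 0"
  shows "m + n - Poly_Mapping.single v 1 = (m - Poly_Mapping.single v 1) + n"
  using assms by (intro poly_mapping_eqI) (auto simp: lookup_add lookup_minus lookup_single when_def)

lemma pdiff_pol_mult_single:
  "pdiff_pol v (Poly_Mapping.single m c * Poly_Mapping.single n d) =
     pdiff_pol v (Poly_Mapping.single m c) * Poly_Mapping.single n d
   + Poly_Mapping.single m c * pdiff_pol v (Poly_Mapping.single n d)"
proof -
  let ?a = "Poly_Mapping.lookup m v" and ?b = "Poly_Mapping.lookup n v"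
  let ?e = "Poly_Mapping.single v (1::nat)"
  have 1: "Poly_Mapping.single (m + n - ?e) (of_nat ?a * (c * d)) =
           Poly_Mapping.single (m - ?e + n) (of_nat ?a * (c * d))"
    by (cases "?a = 0") (simp_all add: monom_diff_add del: One_nat_def)
  have 2: "Poly_Mapping.single (m + n - ?e) (of_nat ?b * (c * d)) =
           Poly_Mapping.single (m + (n - ?e)) (of_nat ?b * (c * d))"
    by (cases "?b = 0") (simp_all add: monom_diff_add[of n v m, unfolded add.commute[of _ m]] del: One_nat_def)
  have "pdiff_pol v (Poly_Mapping.single m c * Poly_Mapping.single n d) =
     Poly_Mapping.single (m + n - ?e) (of_nat ?a * (c * d)) +
     Poly_Mapping.single (m + n - ?e) (of_nat ?b * (c * d))"
    by (simp add: mult_single pdiff_pol_single lookup_add distrib_right single_add)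
  then show ?thesis
    unfolding 1 2 by (simp add: mult_single pdiff_pol_single ac_simps)
qed

lemma pdiff_pol_mult: "pdiff_pol v (f * g) = pdiff_pol v f * g + f * pdiff_pol v g"
proof (induction f rule: pol_induct)
  case zero
  show ?case by (simp add: pdiff_pol_def)
next
  case (single m c)
  show ?case
  proof (induction g rule: pol_induct)
    case zero
    show ?case by (simp add: pdiff_pol_def)
  next
    case (single n d)
    show ?case by (rule pdiff_pol_mult_single)
  next
    case (add g h)
    then show ?case by (simp add: pdiff_pol_add algebra_simps)
  qed
next
  case (add f h)
  then show ?case by (simp add: pdiff_pol_add algebra_simps)
qed

lift_definition pdiff :: "var \<Rightarrow> ratfun \<Rightarrow> ratfun" is
  "\<lambda>v (a, b). (pdiff_pol v a * b - a * pdiff_pol v b, b * b)"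
proof -
  fix v and r r' :: "pol \<times> pol"
  assume *: "fractrel r r'"
  obtain a b c d where r: "r = (a, b)" "r' = (c, d)" by fastforce
  from * r have nz: "b \<noteq> 0" "d \<noteq> 0" and eq: "a * d = c * b" by (auto simp: fractrel_def)
  from eq have "pdiff_pol v (a * d) = pdiff_pol v (c * b)" by simp
  then have eq': "pdiff_pol v a * d + a * pdiff_pol v d = pdiff_pol v c * b + c * pdiff_pol v b"
    by (simp add: pdiff_pol_mult)
  have "(pdiff_pol v a * b - a * pdiff_pol v b) * (d * d)
      = (pdiff_pol v c * d - c * pdiff_pol v d) * (b * b)"
    using eq eq' by algebra
  with nz show "fractrel (case r of (a, b) \<Rightarrow> (pdiff_pol v a * b - a * pdiff_pol v b, b * b))
    (case r' of (a, b) \<Rightarrow> (pdiff_pol v a * b - a * pdiff_pol v b, b * b))"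
    by (simp add: r fractrel_def)
qed

lemma pdiff_Fract:
  assumes "b \<noteq> 0"
  shows "pdiff v (Fract a b) = Fract (pdiff_pol v a * b - a * pdiff_pol v b) (b * b)"
proof -
  have F: "Fract c d = abs_fract (c, d)" if "d \<noteq> 0" for c d :: pol
    using that by (simp add: Fract_def)
  have "pdiff v (abs_fract (a, b)) = abs_fract (pdiff_pol v a * b - a * pdiff_pol v b, b * b)"
    using assms by (subst pdiff.abs_eq) (simp_all add: eq_onp_def)
  then show ?thesis using assms by (simp add: F)
qed

lemma pdiff_pol_one: "pdiff_pol v 1 = 0" using pdiff_pol_single[of v 0 1]
  by simp

lemma pdiff_V: "pdiff v (V u) = (if u = v then 1 else 0)"
  unfolding V_def pdiff_Fract[OF one_neq_zero]
  by (simp add: pdiff_pol_one pdiff_pol_single lookup_single fract_collapse)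

text \<open>
  \<open>rhs_t u a\<^sub>0 a\<^sub>1 v\<close> and \<open>rhs_s u a\<^sub>0 a\<^sub>1 v\<close> are the coefficients of \<open>dt\<close>
  and \<open>ds\<close> in the equation for \<open>dv\<close>, evaluated at \<open>u\<close> and at the parameter values
  \<open>a\<^sub>0, a\<^sub>1\<close>. The independent variables satisfy \<open>dt = 1 dt + 0 ds\<close>,
  \<open>ds = 0 dt + 1 ds\<close>, and the parameter is constant.\<close>

fun rhs_t :: "(var \<Rightarrow> ratfun) \<Rightarrow> ratfun \<Rightarrow> ratfun \<Rightarrow> var \<Rightarrow> ratfun" where
  "rhs_t u a0 a1 T = 1"
| "rhs_t u a0 a1 S = 0"
| "rhs_t u a0 a1 X = - 2 * u X * u P - a0"
| "rhs_t u a0 a1 Y = 2 * u Y * u P + a1"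
| "rhs_t u a0 a1 Z = (u X + u Y) / 2"
| "rhs_t u a0 a1 W = u Z - 2 * u W * u P"
| "rhs_t u a0 a1 Q = u Z + 2 * u Q * u P"
| "rhs_t u a0 a1 P = (u W + u Q) / 2"
| "rhs_t u a0 a1 A0 = 0"

fun rhs_s :: "(var \<Rightarrow> ratfun) \<Rightarrow> ratfun \<Rightarrow> ratfun \<Rightarrow> var \<Rightarrow> ratfun" where
  "rhs_s u a0 a1 T = 0"
| "rhs_s u a0 a1 S = 1"
| "rhs_s u a0 a1 X = - 2 * u X * u Z - 2 * a0 * u W"
| "rhs_s u a0 a1 Y = 2 * u Y * u Z - 2 * a1 * u Q"
| "rhs_s u a0 a1 Z = - u X * u Q + u Y * u W - 2 * u P"
| "rhs_s u a0 a1 W = - 2 * u X * u P - 2 * a0 - a1"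
| "rhs_s u a0 a1 Q = 2 * u Y * u P + a0 + 2 * a1"
| "rhs_s u a0 a1 P = (u X + u Y) / 2"
| "rhs_s u a0 a1 A0 = 0"

text \<open>Total derivatives along the system with parameters \<open>\<alpha>\<^sub>0, \<alpha>\<^sub>1\<close>: by the chain rule,
  \<open>df = D\<^sub>t f dt + D\<^sub>s f ds\<close>.\<close>

definition D_t :: "ratfun \<Rightarrow> ratfun" where
  "D_t f = (\<Sum>v\<in>{T, S, X, Y, Z, W, Q, P, A0}. pdiff v f * rhs_t V alpha0 alpha1 v)"

definition D_s :: "ratfun \<Rightarrow> ratfun" where
  "D_s f = (\<Sum>v\<in>{T, S, X, Y, Z, W, Q, P, A0}. pdiff v f * rhs_s V alpha0 alpha1 v)"

definition field_automorphism :: "(ratfun \<Rightarrow> ratfun) \<Rightarrow> bool" where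
  "field_automorphism \<sigma> \<longleftrightarrow> bij \<sigma> \<and> (\<forall>f g. \<sigma> (f + g) = \<sigma> f + \<sigma> g) \<and>
     (\<forall>f g. \<sigma> (f * g) = \<sigma> f * \<sigma> g) \<and> (\<forall>c. \<sigma> (const c) = const c)"

definition ratfun_over :: "var set \<Rightarrow> ratfun set" where
  "ratfun_over U = {Fract a b |a b. b \<noteq> 0 \<and>
     (\<forall>m \<in> Poly_Mapping.keys a \<union> Poly_Mapping.keys b. Poly_Mapping.keys m \<subseteq> U)}"

text \<open>A birational transformation of the dependent variables and the parameter, regarded as the
  field automorphism sending each variable to its image. The transformed parameters depend on the
  parameters only, and the transformed variables solve the system with the transformed parameters
  whenever the original variables solve the original system.\<close>

definition baecklund :: "(ratfun \<Rightarrow> ratfun) \<Rightarrow> bool" where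
  "baecklund \<sigma> \<longleftrightarrow> field_automorphism \<sigma> \<and>
     \<sigma> (V T) = V T \<and> \<sigma> (V S) = V S \<and>
     \<sigma> alpha0 \<in> ratfun_over {A0} \<and>
     (\<forall>v \<in> {X, Y, Z, W, Q, P}. \<sigma> (V v) \<in> ratfun_over {X, Y, Z, W, Q, P, A0}) \<and>
     (\<forall>v \<in> {X, Y, Z, W, Q, P}.
        D_t (\<sigma> (V v)) = rhs_t (\<lambda>u. \<sigma> (V u)) (\<sigma> alpha0) (\<sigma> alpha1) v \<and>
        D_s (\<sigma> (V v)) = rhs_s (\<lambda>u. \<sigma> (V u)) (\<sigma> alpha0) (\<sigma> alpha1) v)"

text \<open>\<open>acts \<sigma> (x', y', z', w', q', p') (a\<^sub>0', a\<^sub>1')\<close> reads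
  \<open>\<sigma> : (x, y, z, w, q, p; \<alpha>\<^sub>0, \<alpha>\<^sub>1) \<mapsto> (x', y', z', w', q', p'; a\<^sub>0', a\<^sub>1')\<close>.\<close>

definition acts :: "(ratfun \<Rightarrow> ratfun) \<Rightarrow>
    ratfun \<times> ratfun \<times> ratfun \<times> ratfun \<times> ratfun \<times> ratfun \<Rightarrow> ratfun \<times> ratfun \<Rightarrow> bool" where
  "acts \<sigma> xs as \<longleftrightarrow>
     (\<sigma> (V X), \<sigma> (V Y), \<sigma> (V Z), \<sigma> (V W), \<sigma> (V Q), \<sigma> (V P)) = xs \<and> (\<sigma> alpha0, \<sigma> alpha1) = as"

end

theory Submission
  imports Defs
begin

text \<open>Each map is a substitution of rational functions for the variables. It extends to the field of
  fractions only if no nonzero polynomial is sent to zero, and this follows from involutivity: if \<open>d\<close>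
  is the denominator (\<open>x\<close>, \<open>y\<close> or \<open>1\<close>), fixed by the substitution \<open>\<phi>\<close>, then every \<open>\<phi> f\<close> has
  the form \<open>g / d\<^sup>n\<close> with \<open>\<phi> g = f d\<^sup>n\<close>, so that \<open>\<phi> f = 0\<close> forces \<open>g = 0\<close> and \<open>f = 0\<close>. The
  relations between the maps need only be checked on the variables. Since \<open>D_t\<close> and \<open>D_s\<close> are
  derivations with known values on the variables, the differential equations become identities
  between rational functions.\<close>

text \<open>Monomials are written below as products over all of \<open>UNIV\<close>, which calls for
  finitely many variables.\<close>

instance var :: finite
proof
  have "v \<in> {T, S, X, Y, Z, W, Q, P, A0}" for v by (cases v) simp_all
  then show "finite (UNIV :: var set)"
    by (intro finite_subset[of UNIV "{T, S, X, Y, Z, W, Q, P, A0}"]) auto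
qed

text \<open>Characteristic zero makes numerals nonzero, so that the denominator 2 in
  \<open>rhs_t\<close> and \<open>rhs_s\<close> can be cleared.\<close>

instance fract :: ("{idom, ring_char_0}") ring_char_0
  by standard (auto intro!: injI simp: of_nat_fract eq_fract)

instance fract :: ("{idom, ring_char_0}") field_char_0 ..

section \<open>Extending ring homomorphisms to fractions\<close>

text \<open>By \<open>inj\<close> every denominator stays invertible, and cross-multiplication shows
  that the quotient of the images depends on the fraction alone.\<close>

lemma fract_hom_extension:
  fixes \<phi> :: "'a::idom \<Rightarrow> 'b::field"
  assumes add: "\<And>a b. \<phi> (a + b) = \<phi> a + \<phi> b"
    and mult: "\<And>a b. \<phi> (a * b) = \<phi> a * \<phi> b"
    and inj: "\<And>a. \<phi> a = 0 \<Longrightarrow> a = 0"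
  obtains \<sigma> where "\<And>a b. b \<noteq> 0 \<Longrightarrow> \<sigma> (Fract a b) = \<phi> a / \<phi> b"
    and "\<And>r r'. \<sigma> (r + r') = \<sigma> r + \<sigma> r'"
    and "\<And>r r'. \<sigma> (r * r') = \<sigma> r * \<sigma> r'"
proof -
  \<comment> \<open>The choice ranges over all representations of \<open>r\<close>;
    \<open>eq\<close> below shows that they give a single value.\<close>
  define \<sigma> where "\<sigma> r = (SOME y. \<exists>a b. b \<noteq> 0 \<and> r = Fract a b \<and> y = \<phi> a / \<phi> b)" for r
  have nz: "\<phi> b \<noteq> 0" if "b \<noteq> 0" for b using inj that by blast
  have eq: "\<sigma> (Fract a b) = \<phi> a / \<phi> b" if b: "b \<noteq> 0" for a b
    unfolding \<sigma>_def
  proof (rule someI2_ex)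
    show "\<exists>y a' b'. b' \<noteq> 0 \<and> Fract a b = Fract a' b' \<and> y = \<phi> a' / \<phi> b'" using b by blast
  next
    fix y assume "\<exists>a' b'. b' \<noteq> 0 \<and> Fract a b = Fract a' b' \<and> y = \<phi> a' / \<phi> b'"
    then obtain c d where cd: "d \<noteq> 0" "Fract a b = Fract c d" "y = \<phi> c / \<phi> d" by blast
    then have "a * d = c * b" using b by (simp add: eq_fract)
    then have "\<phi> a * \<phi> d = \<phi> c * \<phi> b" by (metis mult)
    then show "y = \<phi> a / \<phi> b" using cd nz b by (simp add: frac_eq_eq)
  qed
  show ?thesis
  proof (rule that[OF eq])
    fix r r' :: "'a fract"
    obtain a b c d where "r = Fract a b" "b \<noteq> 0" "r' = Fract c d" "d \<noteq> 0"
      by (metis Fract_cases)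
    then show "\<sigma> (r + r') = \<sigma> r + \<sigma> r'" "\<sigma> (r * r') = \<sigma> r * \<sigma> r'"
      by (simp_all add: eq add mult nz add_frac_eq)
  qed
qed

section \<open>Polynomials and substitutions\<close>

definition pol_var :: "var \<Rightarrow> pol" where
  "pol_var v = Poly_Mapping.single (Poly_Mapping.single v 1) 1"

definition of_pol :: "pol \<Rightarrow> ratfun" where
  "of_pol f = Fract f 1"

lemma of_pol_simps [simp]:
  "of_pol 0 = 0" "of_pol 1 = 1" "of_pol (f + g) = of_pol f + of_pol g"
  "of_pol (f * g) = of_pol f * of_pol g" "of_pol (- f) = - of_pol f"
  "of_pol (f - g) = of_pol f - of_pol g" "of_pol (pol_var v) = V v"
  by (simp_all add: of_pol_def V_def pol_var_def fract_collapse)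

lemma of_pol_power [simp]: "of_pol (f ^ n) = of_pol f ^ n"
  by (induction n) simp_all

lemma of_pol_numeral [simp]: "of_pol (numeral k) = numeral k"
  by (metis of_nat_fract of_nat_numeral of_pol_def)

lemma of_pol_eq_iff [simp]: "of_pol f = of_pol g \<longleftrightarrow> f = g"
  by (simp add: of_pol_def eq_fract)

lemma of_pol_eq_0_iff [simp]: "of_pol f = 0 \<longleftrightarrow> f = 0"
  using of_pol_eq_iff[of f 0] by simp

lemma Fract_eq_of_pol: "b \<noteq> 0 \<Longrightarrow> Fract a b = of_pol a / of_pol b"
  by (simp add: of_pol_def)

lemma const_eq_of_pol: "const c = of_pol (Poly_Mapping.single 0 c)"
  by (simp add: const_def of_pol_def)

lemma const_simps [simp]:
  "const 0 = 0" "const 1 = 1" "const (c + d) = const c + const d" "const (c * d) = const c * const d"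
  by (simp_all add: const_eq_of_pol single_add mult_single
      flip: of_pol_simps(3,4))

lemma pol_var_neq_0 [simp]: "pol_var v \<noteq> 0"
  by (metis pol_var_def lookup_single_eq lookup_zero zero_neq_one)

lemma V_neq_0 [simp]: "V v \<noteq> 0"
  using of_pol_eq_0_iff[of "pol_var v"] by simp

lemma pol_var_power: "pol_var v ^ n = Poly_Mapping.single (Poly_Mapping.single v n) 1"
  by (induction n) (simp_all add: pol_var_def mult_single flip: single_add)

text \<open>Reduces claims about monomials to constants, variables and products; an exponent vector
  is the sum of its coordinate parts.\<close>

lemma single_eq_prod_pol_var:
  "Poly_Mapping.single m c = Poly_Mapping.single 0 c * (\<Prod>v\<in>UNIV. pol_var v ^ Poly_Mapping.lookup m v)"
proof -
  have "(\<Prod>v\<in>A. pol_var v ^ Poly_Mapping.lookup m v) =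
      Poly_Mapping.single (\<Sum>v\<in>A. Poly_Mapping.single v (Poly_Mapping.lookup m v)) 1"
    if "finite A" for A
    using that by induction (simp_all add: pol_var_power mult_single)
  moreover have "(\<Sum>v\<in>UNIV. Poly_Mapping.single v (Poly_Mapping.lookup m v)) = m"
    by (rule poly_mapping_eqI) (simp add: lookup_sum lookup_single when_def)
  ultimately show ?thesis by (simp add: mult_single)
qed

text \<open>Evaluation at the point \<open>u\<close>. It is defined on polynomials only, since on
  fractions a denominator might be sent to 0.\<close>

definition subst_pol :: "(var \<Rightarrow> ratfun) \<Rightarrow> pol \<Rightarrow> ratfun" where
  "subst_pol u f = (\<Sum>m\<in>Poly_Mapping.keys f.
     const (Poly_Mapping.lookup f m) * (\<Prod>v\<in>UNIV. u v ^ Poly_Mapping.lookup m v))"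

text \<open>Monomials outside the support have coefficient 0, so two polynomials can be summed over
  a common index set, as additivity requires.\<close>

lemma subst_pol_superset:
  assumes "finite K" "Poly_Mapping.keys f \<subseteq> K"
  shows "subst_pol u f = (\<Sum>m\<in>K.
     const (Poly_Mapping.lookup f m) * (\<Prod>v\<in>UNIV. u v ^ Poly_Mapping.lookup m v))"
  unfolding subst_pol_def using assms
  by (intro sum.mono_neutral_left) (auto simp: in_keys_iff)

lemma subst_pol_add [simp]: "subst_pol u (f + g) = subst_pol u f + subst_pol u g"
proof -
  let ?K = "Poly_Mapping.keys f \<union> Poly_Mapping.keys g"
  have K: "finite ?K" by simp
  show ?thesis
    using subst_pol_superset[OF K keys_add] subst_pol_superset[OF K, of f]
      subst_pol_superset[OF K, of g]
    by (simp add: lookup_add distrib_right sum.distrib)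
qed

lemma subst_pol_0 [simp]: "subst_pol u 0 = 0"
  by (simp add: subst_pol_def)

lemma subst_pol_single:
  "subst_pol u (Poly_Mapping.single m c) = const c * (\<Prod>v\<in>UNIV. u v ^ Poly_Mapping.lookup m v)"
  by (cases "c = 0") (simp_all add: subst_pol_def)

lemma subst_pol_const: "subst_pol u (Poly_Mapping.single 0 c) = const c"
  by (simp add: subst_pol_single)

lemma subst_pol_mult [simp]: "subst_pol u (f * g) = subst_pol u f * subst_pol u g"
proof (induction f rule: pol_induct)
  case (single m c)
  show ?case
    by (induction g rule: pol_induct)
      (simp_all add: mult_single subst_pol_single lookup_add power_add prod.distrib algebra_simps)
qed (simp_all add: algebra_simps)

lemma subst_pol_1 [simp]: "subst_pol u 1 = 1"
  using subst_pol_const[of u 1] by simp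

lemma subst_pol_uminus [simp]: "subst_pol u (- f) = - subst_pol u f"
  using subst_pol_add[of u f "- f"] by (simp add: eq_neg_iff_add_eq_0 add.commute)

lemma subst_pol_diff [simp]: "subst_pol u (f - g) = subst_pol u f - subst_pol u g"
  using subst_pol_add[of u f "- g"] by simp

lemma subst_pol_power [simp]: "subst_pol u (f ^ n) = subst_pol u f ^ n"
  by (induction n) simp_all

lemma subst_pol_numeral [simp]: "subst_pol u (numeral k) = numeral k"
proof -
  have "subst_pol u (of_nat n) = of_nat n" for n by (induction n) simp_all
  then show ?thesis by (metis of_nat_numeral)
qed

lemma subst_pol_var [simp]: "subst_pol u (pol_var v) = u v"
  by (simp add: pol_var_def subst_pol_single lookup_single when_def prod.If_cases if_distrib[of "(^) _"]
      cong: if_cong)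

section \<open>Homomorphisms of the field of rational functions\<close>

text \<open>\<open>field_automorphism\<close> without bijectivity, for use on a map before it is
  known to be bijective and on compositions.\<close>

definition ratfun_hom :: "(ratfun \<Rightarrow> ratfun) \<Rightarrow> bool" where
  "ratfun_hom \<sigma> \<longleftrightarrow> (\<forall>f g. \<sigma> (f + g) = \<sigma> f + \<sigma> g) \<and>
     (\<forall>f g. \<sigma> (f * g) = \<sigma> f * \<sigma> g) \<and> (\<forall>c. \<sigma> (const c) = const c)"

lemma field_automorphism_iff: "field_automorphism \<sigma> \<longleftrightarrow> bij \<sigma> \<and> ratfun_hom \<sigma>"
  by (auto simp: field_automorphism_def ratfun_hom_def)

lemma ratfun_hom_comp: "ratfun_hom \<sigma> \<Longrightarrow> ratfun_hom \<tau> \<Longrightarrow> ratfun_hom (\<sigma> \<circ> \<tau>)"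
  by (simp add: ratfun_hom_def)

lemma ratfun_hom_id: "ratfun_hom id"
  by (simp add: ratfun_hom_def)

context
  fixes \<sigma> assumes hom: "ratfun_hom \<sigma>"
begin

lemma ratfun_hom_const: "\<sigma> (const c) = const c"
  and ratfun_hom_add: "\<sigma> (f + g) = \<sigma> f + \<sigma> g"
  and ratfun_hom_mult: "\<sigma> (f * g) = \<sigma> f * \<sigma> g"
  using hom by (auto simp: ratfun_hom_def)

lemma ratfun_hom_0: "\<sigma> 0 = 0" and ratfun_hom_1: "\<sigma> 1 = 1"
  using ratfun_hom_const[of 0] ratfun_hom_const[of 1] by simp_all

lemma ratfun_hom_uminus: "\<sigma> (- f) = - \<sigma> f"
  using ratfun_hom_add[of f "- f"] by (simp add: ratfun_hom_0 eq_neg_iff_add_eq_0 add.commute)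

lemma ratfun_hom_diff: "\<sigma> (f - g) = \<sigma> f - \<sigma> g"
  using ratfun_hom_add[of f "- g"] by (simp add: ratfun_hom_uminus)

lemma ratfun_hom_power: "\<sigma> (f ^ n) = \<sigma> f ^ n"
  by (induction n) (simp_all add: ratfun_hom_1 ratfun_hom_mult)

lemma ratfun_hom_prod: "finite A \<Longrightarrow> \<sigma> (\<Prod>i\<in>A. F i) = (\<Prod>i\<in>A. \<sigma> (F i))"
  by (induction rule: finite_induct) (simp_all add: ratfun_hom_1 ratfun_hom_mult)

lemma ratfun_hom_numeral: "\<sigma> (numeral k) = numeral k"
proof -
  have "\<sigma> (of_nat n) = of_nat n" for n
    by (induction n) (simp_all add: ratfun_hom_0 ratfun_hom_1 ratfun_hom_add)
  then show ?thesis by (metis of_nat_numeral)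
qed

lemma ratfun_hom_divide: "\<sigma> (f / g) = \<sigma> f / \<sigma> g"
\<comment> \<open>For \<open>g = 0\<close> both sides are 0, as division by zero gives 0; otherwise
  the image of \<open>1 / g\<close> inverts \<open>\<sigma> g\<close>.\<close>
proof (cases "g = 0")
  case False
  then have inv: "\<sigma> (1 / g) * \<sigma> g = 1"
    using ratfun_hom_mult[of "1 / g" g] by (simp add: ratfun_hom_1)
  then have "\<sigma> g \<noteq> 0" by auto
  with inv have "\<sigma> (1 / g) = 1 / \<sigma> g" by (simp add: nonzero_eq_divide_eq)
  then show ?thesis using ratfun_hom_mult[of f "1 / g"] by simp
qed (simp add: ratfun_hom_0)

lemma ratfun_hom_of_pol: "\<sigma> (of_pol f) = subst_pol (\<lambda>v. \<sigma> (V v)) f"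
proof (induction f rule: pol_induct)
  case (single m c)
  have "of_pol (\<Prod>v\<in>A. pol_var v ^ Poly_Mapping.lookup m v) = (\<Prod>v\<in>A. V v ^ Poly_Mapping.lookup m v)"
    if "finite A" for A
    using that by induction simp_all
  then have "of_pol (Poly_Mapping.single m c) = const c * (\<Prod>v\<in>UNIV. V v ^ Poly_Mapping.lookup m v)"
    by (subst single_eq_prod_pol_var) (simp add: const_eq_of_pol)
  then show ?case
    by (simp add: subst_pol_single ratfun_hom_mult ratfun_hom_const ratfun_hom_prod ratfun_hom_power)
qed (simp_all add: ratfun_hom_0 ratfun_hom_add)

end

lemmas ratfun_hom_simps = ratfun_hom_0 ratfun_hom_1 ratfun_hom_add ratfun_hom_mult
  ratfun_hom_uminus ratfun_hom_diff ratfun_hom_power ratfun_hom_numeral ratfun_hom_divide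

text \<open>Every element is a quotient of polynomials, and a homomorphism acts on a polynomial by
  substituting the images of the variables.\<close>

lemma ratfun_hom_eqI:
  assumes "ratfun_hom \<sigma>" "ratfun_hom \<tau>" "\<And>v. \<sigma> (V v) = \<tau> (V v)"
  shows "\<sigma> = \<tau>"
proof
  fix r :: ratfun
  obtain a b where "r = Fract a b" "b \<noteq> 0" by (cases r)
  then show "\<sigma> r = \<tau> r"
    by (simp add: Fract_eq_of_pol ratfun_hom_divide[OF assms(1)] ratfun_hom_divide[OF assms(2)]
        ratfun_hom_of_pol[OF assms(1)] ratfun_hom_of_pol[OF assms(2)] assms(3))
qed

lemma involutive_substitution:
  assumes d: "d \<noteq> 0" "subst_pol u d = of_pol d"
    and inv: "\<And>v. \<exists>g n. u v * of_pol d ^ n = of_pol g \<and> subst_pol u g = V v * of_pol d ^ n"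
  obtains \<sigma> where "field_automorphism \<sigma>" "\<And>v. \<sigma> (V v) = u v" "\<sigma> \<circ> \<sigma> = id"
proof -
  \<comment> \<open>The hypothesis \<open>inv\<close> with an arbitrary polynomial in place of a
    variable; it survives sums and products.\<close>
  define R where "R f \<longleftrightarrow> (\<exists>g n. subst_pol u f * of_pol d ^ n = of_pol g \<and>
    subst_pol u g = of_pol f * of_pol d ^ n)" for f
  have R_var: "R (pol_var v)" for v using inv[of v] by (simp add: R_def)
  have R_const: "R (Poly_Mapping.single 0 c)" for c
    unfolding R_def by (rule exI[of _ "Poly_Mapping.single 0 c"], rule exI[of _ 0])
      (simp add: subst_pol_const const_eq_of_pol)
  have R_add: "R (f + f')" if f: "R f" "R f'" for f f'
  proof -
    obtain g n g' n' where *: "subst_pol u f * of_pol d ^ n = of_pol g" "subst_pol u g = of_pol f * of_pol d ^ n"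
      "subst_pol u f' * of_pol d ^ n' = of_pol g'" "subst_pol u g' = of_pol f' * of_pol d ^ n'"
      using f unfolding R_def by blast
    show ?thesis unfolding R_def
      \<comment> \<open>The common denominator is \<open>d ^ (n + n')\<close>; the added factors of
        \<open>d\<close> are fixed by the substitution.\<close>
      by (rule exI[of _ "g * d ^ n' + g' * d ^ n"], rule exI[of _ "n + n'"])
        (simp add: *(2,4) d algebra_simps power_add flip: *(1,3))
  qed
  have R_mult: "R (f * f')" if f: "R f" "R f'" for f f'
  proof -
    obtain g n g' n' where *: "subst_pol u f * of_pol d ^ n = of_pol g" "subst_pol u g = of_pol f * of_pol d ^ n"
      "subst_pol u f' * of_pol d ^ n' = of_pol g'" "subst_pol u g' = of_pol f' * of_pol d ^ n'"
      using f unfolding R_def by blast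
    show ?thesis unfolding R_def
      by (rule exI[of _ "g * g'"], rule exI[of _ "n + n'"])
        (simp add: *(2,4) algebra_simps power_add flip: *(1,3))
  qed
  have R_1: "R 1" using R_const[of 1] by simp
  have R_power: "R (f ^ n)" if "R f" for f n
    using that by (induction n) (auto intro: R_mult R_1)
  have R_prod: "R (\<Prod>v\<in>A. pol_var v ^ k v)" if "finite A" for A and k :: "var \<Rightarrow> nat"
    using that by induction (auto intro: R_1 R_mult R_power R_var)
  have R: "R f" for f
  proof (induction f rule: pol_induct)
    case zero
    show ?case using R_const[of 0] by simp
  next
    case (single m c)
    show ?case by (subst single_eq_prod_pol_var) (intro R_mult R_const R_prod finite)
  qed (rule R_add)
  have inj: "f = 0" if "subst_pol u f = 0" for f
  proof -
    obtain g n where "subst_pol u f * of_pol d ^ n = of_pol g" "subst_pol u g = of_pol f * of_pol d ^ n"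
      using R[of f] unfolding R_def by blast
    \<comment> \<open>Here \<open>of_pol g = 0\<close>, hence \<open>g = 0\<close> and
      \<open>of_pol f * of_pol d ^ n = 0\<close>, while \<open>d\<close> is nonzero.\<close>
    with that d show ?thesis by (metis mult_eq_0_iff mult_zero_left of_pol_eq_0_iff power_not_zero subst_pol_0)
  qed
  obtain \<sigma> where \<sigma>: "\<And>a b. b \<noteq> 0 \<Longrightarrow> \<sigma> (Fract a b) = subst_pol u a / subst_pol u b"
    "\<And>r r'. \<sigma> (r + r') = \<sigma> r + \<sigma> r'" "\<And>r r'. \<sigma> (r * r') = \<sigma> r * \<sigma> r'"
    by (rule fract_hom_extension[of "subst_pol u"]) (use inj in auto)
  have pol: "\<sigma> (of_pol f) = subst_pol u f" for f by (simp add: of_pol_def \<sigma>)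
  have V: "\<sigma> (V v) = u v" for v using pol[of "pol_var v"] by simp
  have hom: "ratfun_hom \<sigma>"
    by (simp add: ratfun_hom_def \<sigma> pol const_eq_of_pol) (simp add: subst_pol_const flip: const_eq_of_pol)
  have "\<sigma> (\<sigma> (V v)) = V v" for v
  proof -
    obtain g n where g: "u v * of_pol d ^ n = of_pol g" "subst_pol u g = V v * of_pol d ^ n"
      using inv[of v] by blast
    \<comment> \<open>Since \<open>\<sigma>\<close> fixes \<open>of_pol d\<close>, its power can be
      moved inside and cancelled at the end.\<close>
    have "\<sigma> (u v) * of_pol d ^ n = \<sigma> (u v * of_pol d ^ n)"
      by (simp add: ratfun_hom_mult[OF hom] ratfun_hom_power[OF hom] pol d)
    also have "\<dots> = V v * of_pol d ^ n" by (simp add: g pol)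
    finally show ?thesis using d by (simp add: V)
  qed
  then have inv: "\<sigma> \<circ> \<sigma> = id"
    by (intro ratfun_hom_eqI ratfun_hom_comp ratfun_hom_id hom) simp
  then have "bij \<sigma>" using o_bij by blast
  with that hom V inv show ?thesis by (simp add: field_automorphism_iff)
qed

section \<open>Derivations\<close>

lemma pdiff_add: "pdiff v (f + g) = pdiff v f + pdiff v g"
proof -
  obtain a b c d where "f = Fract a b" "b \<noteq> 0" "g = Fract c d" "d \<noteq> 0" by (metis Fract_cases)
  then show ?thesis
    by (simp add: pdiff_Fract pdiff_pol_add pdiff_pol_mult eq_fract algebra_simps)
qed

lemma pdiff_mult: "pdiff v (f * g) = pdiff v f * g + f * pdiff v g"
proof -
  obtain a b c d where "f = Fract a b" "b \<noteq> 0" "g = Fract c d" "d \<noteq> 0" by (metis Fract_cases)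
  then show ?thesis
    by (simp add: pdiff_Fract pdiff_pol_mult eq_fract algebra_simps)
qed

text \<open>These two laws already yield derivative 0 for numerals and the quotient rule, which
  covers all numerical coefficients and denominators in the generators.\<close>

definition derivation :: "('a::field \<Rightarrow> 'a) \<Rightarrow> bool" where
  "derivation D \<longleftrightarrow> (\<forall>f g. D (f + g) = D f + D g) \<and> (\<forall>f g. D (f * g) = D f * g + f * D g)"

lemma derivation_D_t: "derivation D_t"
  by (simp add: derivation_def D_t_def pdiff_add pdiff_mult algebra_simps)

lemma derivation_D_s: "derivation D_s"
  by (simp add: derivation_def D_s_def pdiff_add pdiff_mult algebra_simps)

context
  fixes D :: "'a::field \<Rightarrow> 'a" assumes D: "derivation D"
begin

lemma derivation_add: "D (f + g) = D f + D g"
  and derivation_mult: "D (f * g) = D f * g + f * D g"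
  using D by (auto simp: derivation_def)

lemma derivation_0: "D 0 = 0"
  using derivation_mult[of 0 0] by simp

lemma derivation_1: "D 1 = 0"
  using derivation_mult[of 1 1] by (metis add_cancel_right_right mult_1_left mult_1_right)

lemma derivation_uminus: "D (- f) = - D f"
  using derivation_add[of f "- f"] by (simp add: derivation_0 eq_neg_iff_add_eq_0 add.commute)

lemma derivation_diff: "D (f - g) = D f - D g"
  using derivation_add[of f "- g"] by (simp add: derivation_uminus)

lemma derivation_numeral: "D (numeral k) = 0"
proof -
  have "D (of_nat n) = 0" for n
    by (induction n) (simp_all add: derivation_0 derivation_1 derivation_add)
  then show ?thesis by (metis of_nat_numeral)
qed

lemma derivation_divide:
  assumes "g \<noteq> 0"
  shows "D (f / g) = (D f * g - f * D g) / (g * g)"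
proof -
  \<comment> \<open>The Leibniz rule for \<open>f = (f / g) * g\<close>, to be solved for
    \<open>D (f / g)\<close>.\<close>
  have "D f = D (f / g) * g + f / g * D g"
    using derivation_mult[of "f / g" g] assms by simp
  then show ?thesis using assms by (simp add: field_simps)
qed

end

lemmas derivation_simps = derivation_0 derivation_1 derivation_add derivation_mult
  derivation_uminus derivation_diff derivation_numeral derivation_divide

text \<open>Only the partial derivative with respect to \<open>v\<close> itself survives, and it is
  1.\<close>

lemma D_t_V: "D_t (V v) = rhs_t V alpha0 alpha1 v"
  by (cases v) (simp_all add: D_t_def pdiff_V)

lemma D_s_V: "D_s (V v) = rhs_s V alpha0 alpha1 v"
  by (cases v) (simp_all add: D_s_def pdiff_V)

section \<open>Rational functions in some of the variables\<close>

definition pol_over :: "var set \<Rightarrow> pol set" where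
  "pol_over U = {f. \<forall>m \<in> Poly_Mapping.keys f. Poly_Mapping.keys m \<subseteq> U}"

lemma pol_over_1: "1 \<in> pol_over U"
  by (simp add: pol_over_def)

lemma pol_over_var: "v \<in> U \<Longrightarrow> pol_var v \<in> pol_over U"
  by (simp add: pol_over_def pol_var_def)

lemma pol_over_add: "f \<in> pol_over U \<Longrightarrow> g \<in> pol_over U \<Longrightarrow> f + g \<in> pol_over U"
  using keys_add[of f g] by (fastforce simp: pol_over_def)

lemma pol_over_uminus: "f \<in> pol_over U \<Longrightarrow> - f \<in> pol_over U"
  by (simp add: pol_over_def in_keys_iff)

lemma pol_over_mult:
  assumes "f \<in> pol_over U" "g \<in> pol_over U"
  shows "f * g \<in> pol_over U"
  unfolding pol_over_def
proof (intro CollectI ballI)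
  fix m assume "m \<in> Poly_Mapping.keys (f * g)"
  then obtain a b where ab: "m = a + b" "a \<in> Poly_Mapping.keys f" "b \<in> Poly_Mapping.keys g"
    using keys_mult[of f g] by blast
  with assms keys_add[of a b] show "Poly_Mapping.keys m \<subseteq> U"
    unfolding pol_over_def by blast
qed

text \<open>Separates the conditions on numerator and denominator, so that closure properties are
  inherited from the ring \<open>pol_over U\<close>.\<close>

lemma ratfun_over_iff: "r \<in> ratfun_over U \<longleftrightarrow> (\<exists>a\<in>pol_over U. \<exists>b\<in>pol_over U. b \<noteq> 0 \<and> r = Fract a b)"
  unfolding ratfun_over_def pol_over_def by blast

lemma ratfun_over_1: "1 \<in> ratfun_over U"
  unfolding ratfun_over_iff using pol_over_1 by (metis One_fract_def one_neq_zero)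

lemma ratfun_over_V: "v \<in> U \<Longrightarrow> V v \<in> ratfun_over U"
  unfolding ratfun_over_iff using pol_over_1 pol_over_var
  by (metis V_def pol_var_def one_neq_zero)

lemma ratfun_over_add: "r \<in> ratfun_over U \<Longrightarrow> r' \<in> ratfun_over U \<Longrightarrow> r + r' \<in> ratfun_over U"
  unfolding ratfun_over_iff by (metis add_fract mult_eq_0_iff pol_over_add pol_over_mult)

lemma ratfun_over_mult: "r \<in> ratfun_over U \<Longrightarrow> r' \<in> ratfun_over U \<Longrightarrow> r * r' \<in> ratfun_over U"
  unfolding ratfun_over_iff by (metis mult_fract mult_eq_0_iff pol_over_mult)

lemma ratfun_over_uminus: "r \<in> ratfun_over U \<Longrightarrow> - r \<in> ratfun_over U"
  unfolding ratfun_over_iff by (metis minus_fract pol_over_uminus)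

lemma ratfun_over_diff: "r \<in> ratfun_over U \<Longrightarrow> r' \<in> ratfun_over U \<Longrightarrow> r - r' \<in> ratfun_over U"
  using ratfun_over_add[of r U "- r'"] ratfun_over_uminus by simp

lemma ratfun_over_inverse:
  assumes "r \<in> ratfun_over U"
  shows "inverse r \<in> ratfun_over U"
proof (cases "r = 0")
  case False
  \<comment> \<open>A nonzero fraction has a nonzero numerator, so numerator and denominator may be
    exchanged.\<close>
  with assms show ?thesis
    unfolding ratfun_over_iff by (metis inverse_fract fract_collapse(1) eq_fract(2))
qed (use assms in simp)

lemma ratfun_over_divide: "r \<in> ratfun_over U \<Longrightarrow> r' \<in> ratfun_over U \<Longrightarrow> r / r' \<in> ratfun_over U"
  by (simp add: divide_inverse ratfun_over_mult ratfun_over_inverse)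

lemma ratfun_over_power: "r \<in> ratfun_over U \<Longrightarrow> r ^ n \<in> ratfun_over U"
  by (induction n) (auto intro: ratfun_over_1 ratfun_over_mult)

lemma ratfun_over_numeral: "numeral k \<in> ratfun_over U"
  by (induction k) (simp_all only: numeral.simps ratfun_over_1 ratfun_over_add)

lemmas ratfun_over_intros = ratfun_over_1 ratfun_over_V ratfun_over_add ratfun_over_mult
  ratfun_over_uminus ratfun_over_diff ratfun_over_divide ratfun_over_power ratfun_over_numeral

section \<open>The generators\<close>

text \<open>\<open>alpha1\<close> has no entry of its own: being \<open>1 - alpha0\<close>, it goes
  to \<open>1 + alpha0 = alpha1 + 2 * alpha0\<close>.\<close>

fun s0_var :: "var \<Rightarrow> ratfun" where
  "s0_var Y = V Y + 4 * alpha0 * V Z / V X + 4 * alpha0^2 * V W / V X^2"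
| "s0_var Z = V Z + 2 * alpha0 * V W / V X"
| "s0_var Q = V Q + 4 * alpha0 * V P / V X + 2 * alpha0^2 / V X^2"
| "s0_var P = V P + alpha0 / V X"
| "s0_var A0 = - alpha0"
| "s0_var v = V v"

fun s1_var :: "var \<Rightarrow> ratfun" where
  "s1_var X = V X - 4 * alpha1 * V Z / V Y + 4 * alpha1^2 * V Q / V Y^2"
| "s1_var Z = V Z - 2 * alpha1 * V Q / V Y"
| "s1_var W = V W - 4 * alpha1 * V P / V Y - 2 * alpha1^2 / V Y^2"
| "s1_var P = V P + alpha1 / V Y"
| "s1_var A0 = alpha0 + 2 * alpha1"
| "s1_var v = V v"

fun pi_var :: "var \<Rightarrow> ratfun" where
  "pi_var X = - V Y" | "pi_var Y = - V X" | "pi_var Z = - V Z" | "pi_var W = - V Q"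
| "pi_var Q = - V W" | "pi_var P = - V P" | "pi_var A0 = alpha1"
| "pi_var v = V v"

section \<open>The generators as involutive automorphisms\<close>

lemma s0_exists:
  obtains \<sigma> where "field_automorphism \<sigma>" "\<And>v. \<sigma> (V v) = s0_var v" "\<sigma> \<circ> \<sigma> = id"
proof (rule involutive_substitution[of "pol_var X" s0_var])
  \<comment> \<open>No denominator exceeds \<open>V X ^ 2\<close>, so the exponent 2 serves all
    variables, and \<open>g\<close> is the numerator over that square.\<close>
  have *: "\<exists>g n. s0_var v * of_pol (pol_var X) ^ n = of_pol g \<and>
      subst_pol s0_var g = V v * of_pol (pol_var X) ^ n"
    if "s0_var v * V X ^ 2 = of_pol g" "subst_pol s0_var g = V v * V X ^ 2" for g v
    using that by (intro exI[of _ g] exI[of _ 2]) simp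
  fix v
  let ?x = "pol_var X" and ?a = "pol_var A0"
  show "\<exists>g n. s0_var v * of_pol (pol_var X) ^ n = of_pol g \<and>
      subst_pol s0_var g = V v * of_pol (pol_var X) ^ n"
  proof (cases v)
    case Y
    \<comment> \<open>In the second application \<open>alpha0\<close> changes sign and z is already
      shifted, so the terms in \<open>alpha0 ^ 2\<close> cancel as 4 - 8 + 4.\<close>
    show ?thesis unfolding Y
      by (rule *[of _ "pol_var Y * ?x ^ 2 + 4 * ?a * pol_var Z * ?x + 4 * ?a ^ 2 * pol_var W"])
        (simp_all add: field_simps power2_eq_square)
  next
    case Z
    show ?thesis unfolding Z
      by (rule *[of _ "pol_var Z * ?x ^ 2 + 2 * ?a * pol_var W * ?x"])
        (simp_all add: field_simps power2_eq_square)
  next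
    case Q
    \<comment> \<open>With p already shifted, the terms in \<open>alpha0 ^ 2\<close> cancel as 2 - 4
      + 2.\<close>
    show ?thesis unfolding Q
      by (rule *[of _ "pol_var Q * ?x ^ 2 + 4 * ?a * pol_var P * ?x + 2 * ?a ^ 2"])
        (simp_all add: field_simps power2_eq_square)
  next
    case P
    show ?thesis unfolding P
      by (rule *[of _ "pol_var P * ?x ^ 2 + ?a * ?x"])
        (simp_all add: field_simps power2_eq_square)
  next
    case A0
    show ?thesis unfolding A0
      by (rule *[of _ "- ?a * ?x ^ 2"]) simp_all
  qed (use *[of v "pol_var v * ?x ^ 2"] in simp_all)
qed simp_all

lemma s1_exists:
  obtains \<sigma> where "field_automorphism \<sigma>" "\<And>v. \<sigma> (V v) = s1_var v" "\<sigma> \<circ> \<sigma> = id"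
\<comment> \<open>Now y is fixed and carries all denominators.\<close>
proof (rule involutive_substitution[of "pol_var Y" s1_var])
  have *: "\<exists>g n. s1_var v * of_pol (pol_var Y) ^ n = of_pol g \<and>
      subst_pol s1_var g = V v * of_pol (pol_var Y) ^ n"
    if "s1_var v * V Y ^ 2 = of_pol g" "subst_pol s1_var g = V v * V Y ^ 2" for g v
    using that by (intro exI[of _ g] exI[of _ 2]) simp
  fix v
  let ?y = "pol_var Y" and ?a = "1 - pol_var A0"
  show "\<exists>g n. s1_var v * of_pol (pol_var Y) ^ n = of_pol g \<and>
      subst_pol s1_var g = V v * of_pol (pol_var Y) ^ n"
  proof (cases v)
    case X
    show ?thesis unfolding X
      by (rule *[of _ "pol_var X * ?y ^ 2 - 4 * ?a * pol_var Z * ?y + 4 * ?a ^ 2 * pol_var Q"])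
        (simp_all add: field_simps power2_eq_square)
  next
    case Z
    show ?thesis unfolding Z
      by (rule *[of _ "pol_var Z * ?y ^ 2 - 2 * ?a * pol_var Q * ?y"])
        (simp_all add: field_simps power2_eq_square)
  next
    case W
    show ?thesis unfolding W
      by (rule *[of _ "pol_var W * ?y ^ 2 - 4 * ?a * pol_var P * ?y - 2 * ?a ^ 2"])
        (simp_all add: field_simps power2_eq_square)
  next
    case P
    show ?thesis unfolding P
      by (rule *[of _ "pol_var P * ?y ^ 2 + ?a * ?y"])
        (simp_all add: field_simps power2_eq_square)
  next
    case A0
    show ?thesis unfolding A0
      \<comment> \<open>\<open>2 - pol_var A0\<close> is \<open>alpha0 + 2 * alpha1\<close> in terms
        of \<open>alpha0\<close> alone, and 2 - (2 - alpha0) = alpha0.\<close>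
      by (rule *[of _ "(2 - pol_var A0) * ?y ^ 2"]) (simp_all add: algebra_simps)
  qed (use *[of v "pol_var v * ?y ^ 2"] in simp_all)
qed simp_all

lemma pi_exists:
  obtains \<sigma> where "field_automorphism \<sigma>" "\<And>v. \<sigma> (V v) = pi_var v" "\<sigma> \<circ> \<sigma> = id"
\<comment> \<open>All entries of \<open>pi_var\<close> are polynomials, so the denominator 1 and the
  exponent 0 suffice.\<close>
proof (rule involutive_substitution[of 1 pi_var])
  have *: "\<exists>g n. pi_var v * of_pol 1 ^ n = of_pol g \<and> subst_pol pi_var g = V v * of_pol 1 ^ n"
    if "pi_var v = of_pol g" "subst_pol pi_var g = V v" for g v
    using that by (intro exI[of _ g] exI[of _ 0]) simp
  fix v
  show "\<exists>g n. pi_var v * of_pol 1 ^ n = of_pol g \<and> subst_pol pi_var g = V v * of_pol 1 ^ n"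
  proof (cases v)
    case T
    show ?thesis unfolding T by (rule *[of _ "pol_var T"]) simp_all
  next
    case S
    show ?thesis unfolding S by (rule *[of _ "pol_var S"]) simp_all
  next
    case X
    show ?thesis unfolding X by (rule *[of _ "- pol_var Y"]) simp_all
  next
    case Y
    show ?thesis unfolding Y by (rule *[of _ "- pol_var X"]) simp_all
  next
    case Z
    show ?thesis unfolding Z by (rule *[of _ "- pol_var Z"]) simp_all
  next
    case W
    show ?thesis unfolding W by (rule *[of _ "- pol_var Q"]) simp_all
  next
    case Q
    show ?thesis unfolding Q by (rule *[of _ "- pol_var W"]) simp_all
  next
    case P
    show ?thesis unfolding P by (rule *[of _ "- pol_var P"]) simp_all
  next
    case A0
    show ?thesis unfolding A0 by (rule *[of _ "1 - pol_var A0"]) simp_all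
  qed
qed simp_all

section \<open>The differential equations for the generators\<close>

lemma baecklundI:
  assumes "field_automorphism \<sigma>" "\<And>v. \<sigma> (V v) = u v" "u T = V T" "u S = V S"
    and "u A0 \<in> ratfun_over {A0}"
    and "\<And>v. v \<in> {X, Y, Z, W, Q, P} \<Longrightarrow> u v \<in> ratfun_over {X, Y, Z, W, Q, P, A0}"
    and "\<And>v. v \<in> {X, Y, Z, W, Q, P} \<Longrightarrow> D_t (u v) = rhs_t u (u A0) (1 - u A0) v"
    and "\<And>v. v \<in> {X, Y, Z, W, Q, P} \<Longrightarrow> D_s (u v) = rhs_s u (u A0) (1 - u A0) v"
  shows "baecklund \<sigma>"
proof -
  \<comment> \<open>A homomorphism sends \<open>alpha1\<close> to \<open>1 - u A0\<close>, which
    turns the definition into conditions on the table \<open>u\<close>.\<close>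
  have hom: "ratfun_hom \<sigma>" using assms(1) by (simp add: field_automorphism_iff)
  show ?thesis
    unfolding baecklund_def using assms
    by (auto simp: ratfun_hom_simps[OF hom])
qed

text \<open>For instance, the t-derivative of alpha0/x is (2 alpha0 x p + alpha0^2)/x^2, half the
  shift of q, as the equation for p demands while w is fixed.\<close>

lemma baecklund_s0:
  assumes "field_automorphism \<sigma>" "\<And>v. \<sigma> (V v) = s0_var v"
  shows "baecklund \<sigma>"
proof (rule baecklundI[OF assms])
  fix v assume v: "v \<in> {X, Y, Z, W, Q, P}"
  show "D_t (s0_var v) = rhs_t s0_var (s0_var A0) (1 - s0_var A0) v"
    using v by (auto simp: derivation_simps[OF derivation_D_t] D_t_V power2_eq_square field_simps)
  show "D_s (s0_var v) = rhs_s s0_var (s0_var A0) (1 - s0_var A0) v"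
    using v by (auto simp: derivation_simps[OF derivation_D_s] D_s_V power2_eq_square field_simps)
qed (auto intro!: ratfun_over_intros)

text \<open>Here the t-derivative of alpha1/y is -(2 alpha1 y p + alpha1^2)/y^2, half the shift of
  w, while q is fixed.\<close>

lemma baecklund_s1:
  assumes "field_automorphism \<sigma>" "\<And>v. \<sigma> (V v) = s1_var v"
  shows "baecklund \<sigma>"
proof (rule baecklundI[OF assms])
  fix v assume v: "v \<in> {X, Y, Z, W, Q, P}"
  show "D_t (s1_var v) = rhs_t s1_var (s1_var A0) (1 - s1_var A0) v"
    using v by (auto simp: derivation_simps[OF derivation_D_t] D_t_V power2_eq_square field_simps)
  show "D_s (s1_var v) = rhs_s s1_var (s1_var A0) (1 - s1_var A0) v"
    using v by (auto simp: derivation_simps[OF derivation_D_s] D_s_V power2_eq_square field_simps)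
qed (auto intro!: ratfun_over_intros)

text \<open>Up to sign, the equations for x and y trade places, as do those for w and q; those for z
  and p are symmetric.\<close>

lemma baecklund_pi:
  assumes "field_automorphism \<sigma>" "\<And>v. \<sigma> (V v) = pi_var v"
  shows "baecklund \<sigma>"
proof (rule baecklundI[OF assms])
  fix v assume v: "v \<in> {X, Y, Z, W, Q, P}"
  show "D_t (pi_var v) = rhs_t pi_var (pi_var A0) (1 - pi_var A0) v"
    using v by (auto simp: derivation_simps[OF derivation_D_t] D_t_V field_simps)
  show "D_s (pi_var v) = rhs_s pi_var (pi_var A0) (1 - pi_var A0) v"
    using v by (auto simp: derivation_simps[OF derivation_D_s] D_s_V field_simps)
qed (auto intro!: ratfun_over_intros)

theorem theorem1p2:
  shows "let x = V X; y = V Y; z = V Z; w = V W; q = V Q; p = V P; a0 = alpha0; a1 = alpha1 in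
    \<exists>s0 s1 \<pi>.
      baecklund s0 \<and> baecklund s1 \<and> baecklund \<pi> \<and>
      acts s0
        (x, y + 4 * a0 * z / x + 4 * a0^2 * w / x^2, z + 2 * a0 * w / x, w,
         q + 4 * a0 * p / x + 2 * a0^2 / x^2, p + a0 / x)
        (- a0, a1 + 2 * a0) \<and>
      acts s1
        (x - 4 * a1 * z / y + 4 * a1^2 * q / y^2, y, z - 2 * a1 * q / y,
         w - 4 * a1 * p / y - 2 * a1^2 / y^2, q, p + a1 / y)
        (a0 + 2 * a1, - a1) \<and>
      acts \<pi> (- y, - x, - z, - q, - w, - p) (a1, a0) \<and>
      s0 \<circ> s0 = id \<and> s1 \<circ> s1 = id \<and> \<pi> \<circ> \<pi> = id \<and> \<pi> \<circ> s0 = s1 \<circ> \<pi>"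
proof -
  obtain s0 where s0: "field_automorphism s0" "\<And>v. s0 (V v) = s0_var v" "s0 \<circ> s0 = id"
    using s0_exists by blast
  obtain s1 where s1: "field_automorphism s1" "\<And>v. s1 (V v) = s1_var v" "s1 \<circ> s1 = id"
    using s1_exists by blast
  obtain \<pi> where pi: "field_automorphism \<pi>" "\<And>v. \<pi> (V v) = pi_var v" "\<pi> \<circ> \<pi> = id"
    using pi_exists by blast
  have hom: "ratfun_hom s0" "ratfun_hom s1" "ratfun_hom \<pi>"
    using s0 s1 pi by (simp_all add: field_automorphism_iff)
  note simps = hom[THEN ratfun_hom_0] hom[THEN ratfun_hom_1] hom[THEN ratfun_hom_add]
    hom[THEN ratfun_hom_mult] hom[THEN ratfun_hom_uminus] hom[THEN ratfun_hom_diff]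
    hom[THEN ratfun_hom_power] hom[THEN ratfun_hom_numeral] hom[THEN ratfun_hom_divide]
    s0(2) s1(2) pi(2)
  \<comment> \<open>In the formulas of \<open>s0\<close>, \<open>\<pi>\<close> replaces x by -y and
    \<open>alpha0\<close> by \<open>alpha1\<close>; the results match those of \<open>s1\<close> up
    to the signs in \<open>pi_var\<close>.\<close>
  have "\<pi> (s0 (V v)) = s1 (\<pi> (V v))" for v
    by (cases v) (simp_all add: simps)
  then have "\<pi> \<circ> s0 = s1 \<circ> \<pi>"
    by (intro ratfun_hom_eqI ratfun_hom_comp hom) simp
  moreover have "acts s0
        (V X, V Y + 4 * alpha0 * V Z / V X + 4 * alpha0^2 * V W / V X^2,
         V Z + 2 * alpha0 * V W / V X, V W,
         V Q + 4 * alpha0 * V P / V X + 2 * alpha0^2 / V X^2, V P + alpha0 / V X)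
        (- alpha0, alpha1 + 2 * alpha0)"
    by (simp add: acts_def simps)
  moreover have "acts s1
        (V X - 4 * alpha1 * V Z / V Y + 4 * alpha1^2 * V Q / V Y^2, V Y,
         V Z - 2 * alpha1 * V Q / V Y,
         V W - 4 * alpha1 * V P / V Y - 2 * alpha1^2 / V Y^2, V Q, V P + alpha1 / V Y)
        (alpha0 + 2 * alpha1, - alpha1)"
    \<comment> \<open>The last component holds because 1 - (alpha0 + 2 alpha1) = -alpha1 when the
      parameters sum to 1.\<close>
    by (simp add: acts_def simps)
  moreover have "acts \<pi> (- V Y, - V X, - V Z, - V Q, - V W, - V P) (alpha1, alpha0)"
    by (simp add: acts_def simps)
  ultimately show ?thesis
    unfolding Let_def
    using baecklund_s0[OF s0(1,2)] baecklund_s1[OF s1(1,2)] baecklund_pi[OF pi(1,2)] s0(3) s1(3) pi(3)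
    by blast
qed

end
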